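(* Let $G$ be a group and let $\mathcal I$ be an invariant Boolean ideal on $G$ such that some countable subset of $G$ does not belong to $\mathcal I$. Let $n\ge 1$ and let $G=A_1\cup\dots\cup A_n$ be a partition of $G$. Then either (i) $\mathrm{cov}(\Delta_{\mathcal I}(A_i))\le n$ for all $i\in\{1,\dots,n\}$, or else (ii) there are an index $i\in\{1,\dots,n\}$ and a $G$-invariant Boolean ideal $\mathcal J$ on $G$ with $A_i^{-1}\notin\mathcal J$ such that $\mathrm{cov}_{\mathcal J}(\Delta_{\mathcal I}(A_i))<n$.
   Context: A Boolean ideal on a set $X$ is a nonempty proper subfamily $\mathcal I$ of the power set of $X$ such that for any $A,B\in\mathcal I$ every subset $C\subset A\cup B$ belongs to $\mathcal I$. A Boolean ideal $\mathcal I$ on a group $G$ is invariant if $xAy\in\mathcal I$ for all $x,y\in G$, $A\in\mathcal I$; it is $G$-invariant if $xA\in\mathcal I$ for all $x\in G$, $A\in\mathcal I$ (only left translations). "Countable" means finite or countably infinite. For $A\subset G$ put $\Delta_{\mathcal I}(A)=\{g\in G: gA\cap A\notin\mathcal I\}$ and $A^{-1}=\{a^{-1}:a\in A\}$. For a non-empty $A\subset G$, $\mathrm{cov}(A)=\min\{|F|:F\subset G,\ G=FA\}$. For a Boolean ideal $\mathcal J$ on $G$ and $A,B\subset G$ write $A=_{\mathcal J}B$ if $A\triangle B\in\mathcal J$; for non-empty $A\subset G$, $\mathrm{cov}_{\mathcal J}(A)=\min\{|F|:F\subset G,\ FA=_{\mathcal J}G\}$. For the empty set both covering numbers are $\infty$,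 which is larger than any cardinal. *)

theory Defs
  imports
    "HOL-Algebra.Coset"
    "HOL-Library.Countable_Set"
    "HOL-Library.Disjoint_Sets"
    "HOL-Library.Extended_Nat"
begin

definition boolean_ideal :: "'a set \<Rightarrow> 'a set set \<Rightarrow> bool" where
  "boolean_ideal X \<I> \<longleftrightarrow>
     \<I> \<noteq> {} \<and> \<I> \<subset> Pow X \<and> (\<forall>A\<in>\<I>. \<forall>B\<in>\<I>. \<forall>C. C \<subseteq> A \<union> B \<longrightarrow> C \<in> \<I>)"

definition invariant_boolean_ideal :: "('a, 'b) monoid_scheme \<Rightarrow> 'a set set \<Rightarrow> bool" where
  "invariant_boolean_ideal G \<I> \<longleftrightarrow> boolean_ideal (carrier G) \<I> \<and>
     (\<forall>x\<in>carrier G. \<forall>y\<in>carrier G. \<forall>A\<in>\<I>. (x <#\<^bsub>G\<^esub> A) #>\<^bsub>G\<^esub> y \<in> \<I>)"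

definition left_invariant_boolean_ideal :: "('a, 'b) monoid_scheme \<Rightarrow> 'a set set \<Rightarrow> bool" where
  "left_invariant_boolean_ideal G \<J> \<longleftrightarrow> boolean_ideal (carrier G) \<J> \<and>
     (\<forall>x\<in>carrier G. \<forall>A\<in>\<J>. x <#\<^bsub>G\<^esub> A \<in> \<J>)"

definition Delta :: "('a, 'b) monoid_scheme \<Rightarrow> 'a set set \<Rightarrow> 'a set \<Rightarrow> 'a set" where
  "Delta G \<I> A = {g \<in> carrier G. (g <#\<^bsub>G\<^esub> A) \<inter> A \<notin> \<I>}"

text \<open>Covering numbers are compared only with natural numbers, so they take values in
  \<^typ>\<open>enat\<close>: an infinite cardinal is identified with \<^term>\<open>\<infinity> :: enat\<close>.\<close>

definition ecard :: "'a set \<Rightarrow> enat" where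
  "ecard F = (if finite F then enat (card F) else \<infinity>)"

text \<open>For a group \<open>G\<close>, a Boolean ideal \<open>\<J>\<close> on it and nonempty \<open>A \<subseteq> carrier G\<close>, the infima
  below are minima over a nonempty set, since \<open>F = carrier G\<close> is admissible.\<close>

definition cov :: "('a, 'b) monoid_scheme \<Rightarrow> 'a set \<Rightarrow> enat" where
  "cov G A = (if A = {} then \<infinity>
     else Inf {ecard F | F. F \<subseteq> carrier G \<and> carrier G = F <#>\<^bsub>G\<^esub> A})"

definition eq_mod_ideal :: "'a set set \<Rightarrow> 'a set \<Rightarrow> 'a set \<Rightarrow> bool" where
  "eq_mod_ideal \<J> A B \<longleftrightarrow> sym_diff A B \<in> \<J>"

definition cov_mod :: "('a, 'b) monoid_scheme \<Rightarrow> 'a set set \<Rightarrow> 'a set \<Rightarrow> enat" where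
  "cov_mod G \<J> A = (if A = {} then \<infinity>
     else Inf {ecard F | F. F \<subseteq> carrier G \<and> eq_mod_ideal \<J> (F <#>\<^bsub>G\<^esub> A) (carrier G)})"

end

theory Submission
  imports Defs "HOL-Analysis.Function_Topology"
begin

text \<open>Work with means on \<open>G\<close>: normalized positive functionals on bounded functions that vanish
  on \<open>\<I>\<close>. By compactness some mean \<open>m\<close> minimizes the sum over \<open>j\<close> of \<open>s\<^sub>j = sup\<^sub>c m (c A\<^sub>j)\<close>.
  Convolution from the left with any mean does not increase any \<open>s\<^sub>j\<close>, so by minimality it
  preserves each of them.

  If (i) fails for \<open>i\<close>, there are \<open>f\<^sub>0, \<dots>, f\<^sub>n\<close> such that the translates \<open>f\<^sub>k A\<^sub>i\<close> are pairwise
  disjoint modulo \<open>\<I>\<close>, whence the numbers \<open>m (f\<^sub>k A\<^sub>i)\<close> have sum at most 1. As the sum of all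
  \<open>m (f\<^sub>k A\<^sub>j)\<close> is \<open>n + 1\<close>, some \<open>m (f\<^sub>k A\<^sub>j)\<close> exceeds \<open>1/n\<close>, so \<open>s\<^sub>j > 1/n\<close>. Let \<open>\<J>\<close> consist
  of the sets \<open>D\<close> such that, for each \<open>z\<close>, \<open>m {y. z y\<^sup>-\<^sup>1 c \<in> D}\<close> tends to 0 when \<open>c\<close> runs through
  the elements for which \<open>(w * m) (c A\<^sub>j)\<close> tends to \<open>s\<^sub>j\<close> for all means \<open>w\<close>. Then \<open>\<J>\<close> avoids
  \<open>A\<^sub>j\<^sup>-\<^sup>1\<close> but contains \<open>{c. m (c A\<^sub>j) \<le> 1/n}\<close>. A maximal set \<open>F\<close> of elements with
  \<open>m (c A\<^sub>j) > 1/n\<close> whose translates \<open>c A\<^sub>j\<close> are disjoint modulo \<open>\<I>\<close> has fewer than \<open>n\<close> elements,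
  and \<open>F \<Delta>(A\<^sub>j)\<close> contains every \<open>c\<close> with \<open>m (c A\<^sub>j) > 1/n\<close>.\<close>

subsection \<open>Means\<close>

definition bounded_fun :: "'a set \<Rightarrow> ('a \<Rightarrow> real) \<Rightarrow> bool" where
  "bounded_fun X f \<longleftrightarrow> (\<exists>c. \<forall>x\<in>X. \<bar>f x\<bar> \<le> c)"

lemma bounded_funI: "(\<And>x. x \<in> X \<Longrightarrow> \<bar>f x\<bar> \<le> c) \<Longrightarrow> bounded_fun X f"
  unfolding bounded_fun_def by blast

lemma bounded_fun_const [simp]: "bounded_fun X (\<lambda>_. c)"
  by (rule bounded_funI[of _ _ "\<bar>c\<bar>"]) simp

lemma bounded_fun_indicator [simp]: "bounded_fun X (\<lambda>x. indicator S (h x))"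
  by (rule bounded_funI[of _ _ 1]) (simp add: indicator_def)

lemma bounded_fun_indicator' [simp]: "bounded_fun X (indicator S)"
  using bounded_fun_indicator[of X S "\<lambda>x. x"] by simp

lemma bounded_fun_add [simp]:
  assumes "bounded_fun X f" "bounded_fun X g"
  shows "bounded_fun X (\<lambda>x. f x + g x)"
proof -
  obtain c d where "\<forall>x\<in>X. \<bar>f x\<bar> \<le> c" "\<forall>x\<in>X. \<bar>g x\<bar> \<le> d"
    using assms unfolding bounded_fun_def by blast
  then show ?thesis
    by (intro bounded_funI[of _ _ "c + d"]) (smt (verit))
qed

lemma bounded_fun_cmult [simp]:
  assumes "bounded_fun X f"
  shows "bounded_fun X (\<lambda>x. c * f x)"
proof -
  obtain d where d: "\<forall>x\<in>X. \<bar>f x\<bar> \<le> d"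
    using assms unfolding bounded_fun_def by blast
  then show ?thesis
    by (intro bounded_funI[of _ _ "\<bar>c\<bar> * d"]) (simp add: abs_mult mult_left_mono)
qed

lemma bounded_fun_compose:
  assumes "bounded_fun X f" "\<And>x. x \<in> X \<Longrightarrow> h x \<in> X"
  shows "bounded_fun X (\<lambda>x. f (h x))"
  using assms unfolding bounded_fun_def by blast

text \<open>Sending unbounded functions to 0 makes the set of all means compact
  in the topology of pointwise convergence.\<close>

definition mean :: "'a set \<Rightarrow> 'a set set \<Rightarrow> (('a \<Rightarrow> real) \<Rightarrow> real) \<Rightarrow> bool" where
  "mean X \<N> m \<longleftrightarrow> m (\<lambda>_. 1) = 1 \<and>
     (\<forall>f g. bounded_fun X f \<and> bounded_fun X g \<longrightarrow> m (\<lambda>x. f x + g x) = m f + m g) \<and>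
     (\<forall>c f. bounded_fun X f \<longrightarrow> m (\<lambda>x. c * f x) = c * m f) \<and>
     (\<forall>f. bounded_fun X f \<and> (\<forall>x\<in>X. 0 \<le> f x) \<longrightarrow> 0 \<le> m f) \<and>
     (\<forall>f. \<not> bounded_fun X f \<longrightarrow> m f = 0) \<and>
     (\<forall>S\<in>\<N>. m (indicator S) = 0)"

context
  fixes X :: "'a set" and \<N> :: "'a set set" and m :: "('a \<Rightarrow> real) \<Rightarrow> real"
  assumes m: "mean X \<N> m"
begin

lemma mean_one: "m (\<lambda>_. 1) = 1"
  and mean_add: "bounded_fun X f \<Longrightarrow> bounded_fun X g \<Longrightarrow> m (\<lambda>x. f x + g x) = m f + m g"
  and mean_cmult: "bounded_fun X f \<Longrightarrow> m (\<lambda>x. c * f x) = c * m f"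
  and mean_nonneg: "bounded_fun X f \<Longrightarrow> (\<And>x. x \<in> X \<Longrightarrow> 0 \<le> f x) \<Longrightarrow> 0 \<le> m f"
  and mean_unbounded: "\<not> bounded_fun X f \<Longrightarrow> m f = 0"
  and mean_null: "S \<in> \<N> \<Longrightarrow> m (indicator S) = 0"
  using m unfolding mean_def by auto

lemma mean_const: "m (\<lambda>_. c) = c"
  using mean_cmult[of "\<lambda>_. 1" c] mean_one by simp

lemma mean_mono:
  assumes "bounded_fun X f" "bounded_fun X g" "\<And>x. x \<in> X \<Longrightarrow> f x \<le> g x"
  shows "m f \<le> m g"
proof -
  have "0 \<le> m (\<lambda>x. g x + (-1) * f x)"
    using assms by (intro mean_nonneg bounded_fun_add bounded_fun_cmult) auto
  also have "\<dots> = m g + m (\<lambda>x. (-1) * f x)"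
    using assms by (intro mean_add bounded_fun_cmult)
  also have "m (\<lambda>x. (-1) * f x) = (-1) * m f"
    using assms by (intro mean_cmult)
  finally show ?thesis by simp
qed

text \<open>Functions are total on the type, so values outside \<open>X\<close> have to be
  discarded. Boundedness too only sees \<open>X\<close>, so \<open>f\<close> and \<open>g\<close>
  are unbounded together and then both get the default 0.\<close>

lemma mean_cong:
  assumes "\<And>x. x \<in> X \<Longrightarrow> f x = g x"
  shows "m f = m g"
proof (cases "bounded_fun X f")
  case True
  then have "bounded_fun X g" using assms unfolding bounded_fun_def by metis
  with True show ?thesis using assms by (intro antisym mean_mono) auto
next
  case False
  then have "\<not> bounded_fun X g" using assms unfolding bounded_fun_def by metis
  with False show ?thesis by (simp add: mean_unbounded)
qed

lemma mean_abs_le: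
  assumes "\<And>x. x \<in> X \<Longrightarrow> \<bar>f x\<bar> \<le> c"
  shows "\<bar>m f\<bar> \<le> c"
proof -
  have b: "bounded_fun X f" using assms by (rule bounded_funI)
  have "m f \<le> m (\<lambda>_. c)" "m (\<lambda>_. - c) \<le> m f"
    using assms b by (intro mean_mono; force)+
  then show ?thesis by (simp add: mean_const abs_le_iff)
qed

lemma mean_indicator_nonneg: "0 \<le> m (\<lambda>x. indicator S (h x))"
  by (intro mean_nonneg) auto

lemma mean_indicator_le_one: "m (\<lambda>x. indicator S (h x)) \<le> 1"
  using mean_abs_le[of "\<lambda>x. indicator S (h x)" 1] by (auto simp: indicator_def)

lemma mean_indicator_Un:
  assumes "S \<inter> T \<in> \<N>"
  shows "m (indicator (S \<union> T)) = m (indicator S) + m (indicator T)"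
proof -
  have "m (indicator S) + m (indicator T) = m (\<lambda>x. indicator S x + indicator T x)"
    by (simp add: mean_add)
  also have "\<dots> = m (\<lambda>x. indicator (S \<union> T) x + indicator (S \<inter> T) x)"
    by (intro mean_cong) (auto simp: indicator_def)
  also have "\<dots> = m (indicator (S \<union> T)) + m (indicator (S \<inter> T))"
    by (intro mean_add) auto
  finally show ?thesis using assms by (simp add: mean_null)
qed

end

section \<open>Compactness of the set of means\<close>

lemma compact_box:
  fixes b :: "'b \<Rightarrow> real set"
  assumes "\<And>f. compact (b f)"
  shows "compact {m. \<forall>f. m f \<in> b f}"
proof -
  have "compactin (product_topology (\<lambda>_. euclidean) UNIV) (PiE UNIV b)"
    using assms by (simp add: compactin_PiE)
  then have "compact (PiE UNIV b)"
    by (simp add: euclidean_product_topology)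
  also have "PiE UNIV b = {m. \<forall>f. m f \<in> b f}"
    by auto
  finally show ?thesis .
qed

text \<open>Every clause of \<open>mean\<close> is an equation or inequality between finitely many
  values of \<open>m\<close>, guarded only by conditions that do not involve \<open>m\<close>; such
  clauses are closed under pointwise convergence.\<close>

lemma closed_means: "closed {m. mean X \<N> m}"
proof -
  have *: "closed {m :: ('a \<Rightarrow> real) \<Rightarrow> real. \<forall>S\<in>\<N>. m (indicator S) = 0}"
    unfolding Ball_def
    by (intro closed_Collect_all closed_Collect_imp open_Collect_const closed_Collect_eq
      continuous_on_product_coordinates continuous_intros)
  show ?thesis
    unfolding mean_def using *
    by (intro closed_Collect_conj closed_Collect_all closed_Collect_imp open_Collect_const
      closed_Collect_eq closed_Collect_le continuous_on_product_coordinates continuous_intros)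
qed

text \<open>As in the Banach-Alaoglu theorem: a bound of \<open>f\<close> confines
  \<open>m f\<close> to an interval that does not depend on \<open>m\<close>, so the closed set of
  means lies in a compact box.\<close>

lemma compact_means: "compact {m. mean X \<N> m}"
proof -
  define b where "b f = (if bounded_fun X f then SOME c. \<forall>x\<in>X. \<bar>f x\<bar> \<le> c else 0)"
    for f :: "'a \<Rightarrow> real"
  have "\<bar>m f\<bar> \<le> b f" if m: "mean X \<N> m" for m f
  proof (cases "bounded_fun X f")
    case True
    then have "\<forall>x\<in>X. \<bar>f x\<bar> \<le> b f"
      using someI_ex[of "\<lambda>c. \<forall>x\<in>X. \<bar>f x\<bar> \<le> c"] by (auto simp: b_def bounded_fun_def)
    then show ?thesis using mean_abs_le[OF m] by blast
  next
    case False
    then show ?thesis using mean_unbounded[OF m] by (simp add: b_def)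
  qed
  then have "{m. mean X \<N> m} = {m. mean X \<N> m} \<inter> {m. \<forall>f. m f \<in> {- b f..b f}}"
    by (auto simp: abs_le_iff) (smt (verit))
  then show ?thesis
    using closed_Int_compact[OF closed_means compact_box[of "\<lambda>f. {- b f..b f}"], of X \<N>]
    by (simp only: compact_Icc)
qed

section \<open>Boolean ideals and the choice of a minimal mean\<close>

lemma boolean_ideal_subset:
  "boolean_ideal X \<N> \<Longrightarrow> S \<in> \<N> \<Longrightarrow> T \<subseteq> S \<Longrightarrow> T \<in> \<N>"
  unfolding boolean_ideal_def by blast

lemma boolean_ideal_Un:
  "boolean_ideal X \<N> \<Longrightarrow> S \<in> \<N> \<Longrightarrow> T \<in> \<N> \<Longrightarrow> S \<union> T \<in> \<N>"
  unfolding boolean_ideal_def by (meson order_refl)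

lemma boolean_ideal_Union:
  assumes "boolean_ideal X \<N>" "finite \<F>" "\<F> \<subseteq> \<N>"
  shows "\<Union>\<F> \<in> \<N>"
  using assms(2,3)
proof (induction \<F> rule: finite_induct)
  case empty
  obtain S where "S \<in> \<N>" using assms(1) unfolding boolean_ideal_def by blast
  then show ?case using boolean_ideal_subset[OF assms(1)] by simp
next
  case (insert S \<F>)
  then show ?case using boolean_ideal_Un[OF assms(1)] by simp
qed

lemma boolean_ideal_carrier: "boolean_ideal X \<N> \<Longrightarrow> X \<notin> \<N>"
  unfolding boolean_ideal_def by blast

text \<open>The point mass at \<open>x\<close>. Its null family is left empty because it gives value
  1 to every set containing \<open>x\<close>.\<close>

lemma mean_point:
  assumes "x \<in> X"
  shows "mean X {} (\<lambda>f. if bounded_fun X f then f x else 0)"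
  using assms unfolding mean_def by auto

text \<open>A finite part of \<open>\<N>\<close> has its union in \<open>\<N>\<close>, hence misses
  a point of \<open>X\<close>, and the point mass there vanishes on all its members. Compactness
  passes from finite parts to \<open>\<N>\<close>.\<close>

lemma mean_exists:
  assumes "boolean_ideal X \<N>"
  shows "\<exists>m. mean X \<N> m"
proof -
  have "{m. mean X {} m} \<inter> (\<Inter>S\<in>\<N>. {m. m (indicator S) = 0}) \<noteq> {}"
  proof (rule compact_imp_fip_image[OF compact_means])
    show "closed {m :: ('a \<Rightarrow> real) \<Rightarrow> real. m (indicator S) = 0}" for S
      by (intro closed_Collect_eq continuous_on_product_coordinates continuous_intros)
  next
    fix \<F> assume "finite \<F>" "\<F> \<subseteq> \<N>"
    then have "\<Union>\<F> \<in> \<N>" by (rule boolean_ideal_Union[OF assms])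
    then obtain x where x: "x \<in> X" "x \<notin> \<Union>\<F>"
      using boolean_ideal_carrier[OF assms] boolean_ideal_subset[OF assms] by blast
    then show "{m. mean X {} m} \<inter> (\<Inter>S\<in>\<F>. {m. m (indicator S) = 0}) \<noteq> {}"
      using mean_point[OF x(1)] by (auto intro!: exI[of _ "\<lambda>f. if bounded_fun X f then f x else 0"])
  qed
  then show ?thesis unfolding mean_def by auto
qed

text \<open>The numbers \<open>s j\<close> are carried along as upper bounds rather than defined as
  suprema: the constraints on the pair \<open>(m, s)\<close> are then closed and the sum to be
  minimized is continuous. Confining \<open>s j\<close> for every \<open>j\<close> of the type makes
  the second factor a compact box.\<close>

lemma minimal_mean_exists:
  fixes U :: "'j \<Rightarrow> 'c \<Rightarrow> 'a set" and J :: "'j set" and C :: "'c set"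
  assumes "boolean_ideal X \<N>"
  obtains m s where "mean X \<N> m" "\<And>j. s j \<in> {0..1::real}"
    and "\<And>j c. j \<in> J \<Longrightarrow> c \<in> C \<Longrightarrow> m (indicator (U j c)) \<le> s j"
    and "\<forall>m' s'. mean X \<N> m' \<and> (\<forall>j. s' j \<in> {0..1}) \<and>
      (\<forall>j\<in>J. \<forall>c\<in>C. m' (indicator (U j c)) \<le> s' j) \<longrightarrow> sum s J \<le> sum s' J"
proof -
  define T where "T = ({m. mean X \<N> m} \<times> {s. \<forall>j. s j \<in> {0..1}}) \<inter>
      {p. \<forall>j\<in>J. \<forall>c\<in>C. fst p (indicator (U j c)) \<le> snd p j}"
  have T_iff: "p \<in> T \<longleftrightarrow> mean X \<N> (fst p) \<and> (\<forall>j. snd p j \<in> {0..1}) \<and>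
      (\<forall>j\<in>J. \<forall>c\<in>C. fst p (indicator (U j c)) \<le> snd p j)" for p
    unfolding T_def by (cases p) simp
  have cont_fst: "continuous_on S (\<lambda>p :: (('a \<Rightarrow> real) \<Rightarrow> real) \<times> ('j \<Rightarrow> real). fst p f)" for S f
    by (rule continuous_on_product_then_coordinatewise[OF continuous_on_fst[OF continuous_on_id]])
  have cont_snd: "continuous_on S (\<lambda>p :: (('a \<Rightarrow> real) \<Rightarrow> real) \<times> ('j \<Rightarrow> real). snd p j)" for S j
    by (rule continuous_on_product_then_coordinatewise[OF continuous_on_snd[OF continuous_on_id]])
  have "closed {p :: (('a \<Rightarrow> real) \<Rightarrow> real) \<times> ('j \<Rightarrow> real).
      \<forall>j\<in>J. \<forall>c\<in>C. fst p (indicator (U j c)) \<le> snd p j}"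
    unfolding Ball_def
    by (intro closed_Collect_all closed_Collect_imp open_Collect_const closed_Collect_le
        cont_fst cont_snd)
  moreover have "compact ({m. mean X \<N> m} \<times> {s :: 'j \<Rightarrow> real. \<forall>j. s j \<in> {0..1}})"
    by (intro compact_Times compact_means compact_box) auto
  ultimately have "compact T"
    unfolding T_def by (intro compact_Int_closed)
  moreover have "T \<noteq> {}"
  proof -
    obtain m where m: "mean X \<N> m" using mean_exists[OF assms(1)] by blast
    then have "(m, \<lambda>_. 1) \<in> T"
      using mean_indicator_le_one[OF m, of _ "\<lambda>x. x"] unfolding T_iff by simp
    then show ?thesis by blast
  qed
  moreover have "continuous_on T (\<lambda>p. \<Sum>j\<in>J. snd p j)"
    by (intro continuous_on_sum cont_snd)
  ultimately obtain p where p: "p \<in> T"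
    and min: "\<forall>q\<in>T. (\<Sum>j\<in>J. snd p j) \<le> (\<Sum>j\<in>J. snd q j)"
    using continuous_attains_inf by blast
  show thesis
  proof (rule that)
    show "mean X \<N> (fst p)" "\<And>j. snd p j \<in> {0..1}"
      "\<And>j c. j \<in> J \<Longrightarrow> c \<in> C \<Longrightarrow> fst p (indicator (U j c)) \<le> snd p j"
      using p unfolding T_iff by blast+
    have "sum (snd p) J \<le> sum s' J" if "(m', s') \<in> T" for m' s'
      using min that by fastforce
    then show "\<forall>m' s'. mean X \<N> m' \<and> (\<forall>j. s' j \<in> {0..1}) \<and>
        (\<forall>j\<in>J. \<forall>c\<in>C. m' (indicator (U j c)) \<le> s' j) \<longrightarrow> sum (snd p) J \<le> sum s' J"
      unfolding T_iff fst_conv snd_conv by blast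
  qed
qed

text \<open>By induction: the new set meets the union of the previous ones in a finite union of
  members of \<open>\<N>\<close>.\<close>

lemma sum_mean_indicator:
  assumes "boolean_ideal X \<N>" "mean X \<N> m" "finite K"
    and "\<And>k l. k \<in> K \<Longrightarrow> l \<in> K \<Longrightarrow> k \<noteq> l \<Longrightarrow> U k \<inter> U l \<in> \<N>"
  shows "(\<Sum>k\<in>K. m (indicator (U k))) = m (indicator (\<Union>k\<in>K. U k))"
  using assms(3,4)
proof (induction K rule: finite_induct)
  case empty
  have "(indicator {} :: 'a \<Rightarrow> real) = (\<lambda>_. 0)" by auto
  then show ?case using mean_const[OF assms(2), of 0] by simp
next
  case (insert k K)
  have "U k \<inter> (\<Union>l\<in>K. U l) = \<Union>((\<lambda>l. U k \<inter> U l) ` K)" by auto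
  also have "\<dots> \<in> \<N>"
    using insert by (intro boolean_ideal_Union[OF assms(1)]) auto
  finally show ?case
    using insert mean_indicator_Un[OF assms(2)] by simp
qed


subsection \<open>Convolution and extremal means\<close>

lemma mean_average:
  assumes "mean X \<N> v" "mean X \<N> w"
  shows "mean X \<N> (\<lambda>f. (v f + w f) / 2)"
  using mean_one[OF assms(1)] mean_one[OF assms(2)] mean_null[OF assms(1)] mean_null[OF assms(2)]
    mean_nonneg[OF assms(1)] mean_nonneg[OF assms(2)]
  unfolding mean_def[of X \<N> "\<lambda>f. (v f + w f) / 2"]
  by (simp add: mean_add[OF assms(1)] mean_add[OF assms(2)] mean_cmult[OF assms(1)]
      mean_cmult[OF assms(2)] mean_unbounded[OF assms(1)] mean_unbounded[OF assms(2)]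
      field_simps)

text \<open>Integrates \<open>f (g \<otimes> y)\<close> first over \<open>y\<close> by
  \<open>m\<close>, then over \<open>g\<close> by \<open>w\<close>; the order matters, since
  Fubini's theorem fails for finitely additive means. The default 0 follows the convention of
  \<open>mean\<close>.\<close>

definition convolution ::
  "('a, 'b) monoid_scheme \<Rightarrow> (('a \<Rightarrow> real) \<Rightarrow> real) \<Rightarrow> (('a \<Rightarrow> real) \<Rightarrow> real) \<Rightarrow> ('a \<Rightarrow> real) \<Rightarrow> real" where
  "convolution G w m f =
     (if bounded_fun (carrier G) f then w (\<lambda>g. m (\<lambda>y. f (g \<otimes>\<^bsub>G\<^esub> y))) else 0)"

context group
begin

lemma mem_l_coset_iff:
  assumes "c \<in> carrier G" "y \<in> carrier G" "A \<subseteq> carrier G"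
  shows "y \<in> c <# A \<longleftrightarrow> inv c \<otimes> y \<in> A"
proof
  assume "y \<in> c <# A"
  then obtain a where "a \<in> A" "y = c \<otimes> a" unfolding l_coset_def by blast
  then show "inv c \<otimes> y \<in> A" using assms by (auto simp: m_assoc[symmetric] subset_iff)
next
  assume "inv c \<otimes> y \<in> A"
  moreover have "y = c \<otimes> (inv c \<otimes> y)" using assms by (simp add: m_assoc[symmetric])
  ultimately show "y \<in> c <# A" unfolding l_coset_def by blast
qed

lemma bounded_fun_l_mult:
  "bounded_fun (carrier G) f \<Longrightarrow> g \<in> carrier G \<Longrightarrow> bounded_fun (carrier G) (\<lambda>y. f (g \<otimes> y))"
  by (rule bounded_fun_compose) auto

lemma bounded_fun_mean_l_mult:
  assumes "mean (carrier G) \<N> m" "bounded_fun (carrier G) f"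
  shows "bounded_fun (carrier G) (\<lambda>g. m (\<lambda>y. f (g \<otimes> y)))"
proof -
  obtain c where "\<forall>x\<in>carrier G. \<bar>f x\<bar> \<le> c" using assms(2) unfolding bounded_fun_def by blast
  then show ?thesis
    by (intro bounded_funI[of _ _ c] mean_abs_le[OF assms(1)]) auto
qed

text \<open>Vanishing on \<open>\<N>\<close> comes from the inner mean: for
  \<open>S \<in> \<N>\<close> it is 0 on every translate \<open>inv x <# S\<close>, so
  \<open>w\<close> integrates the zero function. Hence \<open>w\<close> may be any mean on the
  group.\<close>

lemma mean_convolution:
  assumes w: "mean (carrier G) {} w" and m: "mean (carrier G) \<N> m"
    and \<N>: "\<N> \<subseteq> Pow (carrier G)" "\<And>x S. x \<in> carrier G \<Longrightarrow> S \<in> \<N> \<Longrightarrow> x <# S \<in> \<N>"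
  shows "mean (carrier G) \<N> (convolution G w m)"
  unfolding mean_def
proof (intro conjI allI impI ballI; (elim conjE)?)
  show "convolution G w m (\<lambda>_. 1) = 1"
    by (simp add: convolution_def mean_one[OF m] mean_one[OF w])
next
  fix f g assume b: "bounded_fun (carrier G) f" "bounded_fun (carrier G) g"
  have "w (\<lambda>x. m (\<lambda>y. f (x \<otimes> y) + g (x \<otimes> y))) =
      w (\<lambda>x. m (\<lambda>y. f (x \<otimes> y)) + m (\<lambda>y. g (x \<otimes> y)))"
    using b by (intro mean_cong[OF w] mean_add[OF m] bounded_fun_l_mult)
  also have "\<dots> = w (\<lambda>x. m (\<lambda>y. f (x \<otimes> y))) + w (\<lambda>x. m (\<lambda>y. g (x \<otimes> y)))"
    using b by (intro mean_add[OF w] bounded_fun_mean_l_mult[OF m])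
  finally show "convolution G w m (\<lambda>x. f x + g x) = convolution G w m f + convolution G w m g"
    using b by (simp add: convolution_def)
next
  fix c :: real and f assume b: "bounded_fun (carrier G) f"
  have "w (\<lambda>x. m (\<lambda>y. c * f (x \<otimes> y))) = w (\<lambda>x. c * m (\<lambda>y. f (x \<otimes> y)))"
    using b by (intro mean_cong[OF w] mean_cmult[OF m] bounded_fun_l_mult)
  also have "\<dots> = c * w (\<lambda>x. m (\<lambda>y. f (x \<otimes> y)))"
    using b by (intro mean_cmult[OF w] bounded_fun_mean_l_mult[OF m])
  finally show "convolution G w m (\<lambda>x. c * f x) = c * convolution G w m f"
    using b by (simp add: convolution_def)
next
  fix f :: "'a \<Rightarrow> real"
  assume b: "bounded_fun (carrier G) f" and "\<forall>x\<in>carrier G. 0 \<le> f x"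
  then have "0 \<le> w (\<lambda>x. m (\<lambda>y. f (x \<otimes> y)))"
    by (intro mean_nonneg[OF w] bounded_fun_mean_l_mult[OF m] mean_nonneg[OF m] bounded_fun_l_mult) auto
  then show "0 \<le> convolution G w m f" using b by (simp add: convolution_def)
next
  fix f assume "\<not> bounded_fun (carrier G) f"
  then show "convolution G w m f = 0" by (simp add: convolution_def)
next
  fix S assume S: "S \<in> \<N>"
  have "m (\<lambda>y. indicator S (x \<otimes> y)) = 0" if x: "x \<in> carrier G" for x
  proof -
    have "m (\<lambda>y. indicator S (x \<otimes> y)) = m (indicator (inv x <# S))"
      using x S \<N>(1) by (intro mean_cong[OF m]) (auto simp: indicator_def mem_l_coset_iff)
    also have "\<dots> = 0" using x S by (intro mean_null[OF m] \<N>(2)) auto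
    finally show ?thesis .
  qed
  then have "w (\<lambda>x. m (\<lambda>y. indicator S (x \<otimes> y))) = w (\<lambda>_. 0)"
    by (intro mean_cong[OF w])
  then show "convolution G w m (indicator S) = 0"
    by (simp add: convolution_def mean_const[OF w])
qed

lemma convolution_l_coset:
  assumes w: "mean (carrier G) \<M> w" and m: "mean (carrier G) \<N> m"
    and "A \<subseteq> carrier G" "c \<in> carrier G"
  shows "convolution G w m (indicator (c <# A)) = w (\<lambda>g. m (indicator ((inv g \<otimes> c) <# A)))"
proof -
  have "m (\<lambda>y. indicator (c <# A) (g \<otimes> y)) = m (indicator ((inv g \<otimes> c) <# A))"
    if "g \<in> carrier G" for g
    using that assms(3,4)
    by (intro mean_cong[OF m]) (auto simp: indicator_def mem_l_coset_iff inv_mult_group m_assoc)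
  then show ?thesis
    unfolding convolution_def by (auto intro!: mean_cong[OF w])
qed

text \<open>The convolution is an average of the values of \<open>m\<close> on translates of
  \<open>A\<close>, all at most \<open>s\<close>.\<close>

lemma convolution_l_coset_le:
  assumes w: "mean (carrier G) \<M> w" and m: "mean (carrier G) \<N> m"
    and "A \<subseteq> carrier G" "c \<in> carrier G"
    and le: "\<And>c. c \<in> carrier G \<Longrightarrow> m (indicator (c <# A)) \<le> s"
  shows "convolution G w m (indicator (c <# A)) \<le> s"
proof -
  have nn: "0 \<le> m (indicator (x <# A))" for x
    using mean_indicator_nonneg[OF m, of _ "\<lambda>x. x"] by simp
  have "w (\<lambda>g. m (indicator ((inv g \<otimes> c) <# A))) \<le> w (\<lambda>_. s)"
    using assms(4) le nn
    by (intro mean_mono[OF w] bounded_funI[of _ _ s]) (auto simp: abs_le_iff, smt (verit))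
  then show ?thesis
    using assms by (simp add: convolution_l_coset[OF w m] mean_const[OF w])
qed


text \<open>The sets given by \<open>near\<close> form a filter base along which
  \<open>m (c A)\<close> tends to \<open>s\<close>. As \<open>inv y \<otimes> c\<close> lies in
  \<open>set_inv A\<close> iff \<open>y\<close> lies in \<open>c <# A\<close>, the set
  \<open>set_inv A\<close> keeps mass close to \<open>s > 0\<close> along it, whereas a Markov
  inequality makes the mass of the low values tend to 0.\<close>

lemma ideal_of_extremal_mean:
  assumes m: "mean (carrier G) \<N> m" and A: "A \<subseteq> carrier G"
    and le: "\<And>c. c \<in> carrier G \<Longrightarrow> m (indicator (c <# A)) \<le> s"
    and extremal: "\<And>w \<delta>. mean (carrier G) {} w \<Longrightarrow> 0 < \<delta> \<Longrightarrow>
      \<exists>c\<in>carrier G. s - \<delta> < convolution G w m (indicator (c <# A))"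
    and t: "0 \<le> t" "t < s"
  shows "\<exists>\<J>. left_invariant_boolean_ideal G \<J> \<and> set_inv A \<notin> \<J> \<and>
    {c \<in> carrier G. m (indicator (c <# A)) \<le> t} \<in> \<J>"
proof -
  define near where "near w \<delta> c \<longleftrightarrow> c \<in> carrier G \<and> s - \<delta> < convolution G w m (indicator (c <# A))"
    for w \<delta> c
  \<comment> \<open>The parameter \<open>z\<close> is what makes \<open>\<J>\<close> left invariant:
    replacing \<open>D\<close> by \<open>x <# D\<close> amounts to replacing \<open>z\<close> by
    \<open>inv x \<otimes> z\<close>.\<close>
  define small where "small D z \<epsilon> \<longleftrightarrow> (\<exists>w \<delta>. mean (carrier G) {} w \<and> 0 < \<delta> \<and>
      (\<forall>c. near w \<delta> c \<longrightarrow> m (\<lambda>y. indicator D (z \<otimes> inv y \<otimes> c)) < \<epsilon>))"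
    for D z and \<epsilon> :: real
  define \<J> where "\<J> = {D. D \<subseteq> carrier G \<and> (\<forall>z\<in>carrier G. \<forall>\<epsilon>>0. small D z \<epsilon>)}"
  \<comment> \<open>The sets of \<open>c\<close> near the supremum form a filter base: average the two means. This works
    because each convolution is bounded by \<open>s\<close>.\<close>
  have common: "\<exists>w \<delta>. mean (carrier G) {} w \<and> 0 < \<delta> \<and> (\<forall>c. near w \<delta> c \<longrightarrow> near v \<alpha> c \<and> near u \<beta> c)"
    if v: "mean (carrier G) {} v" "0 < \<alpha>" and u: "mean (carrier G) {} u" "0 < \<beta>" for v u \<alpha> \<beta>
  proof (intro exI conjI allI impI)
    let ?w = "\<lambda>f. (v f + u f) / 2" and ?\<delta> = "min \<alpha> \<beta> / 2"
    show "mean (carrier G) {} ?w" using mean_average v u by blast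
    show "0 < ?\<delta>" using v u by simp
    fix c assume c: "near ?w ?\<delta> c"
    then have cG: "c \<in> carrier G" by (simp add: near_def)
    have "convolution G ?w m (indicator (c <# A)) =
        (convolution G v m (indicator (c <# A)) + convolution G u m (indicator (c <# A))) / 2"
      by (simp add: convolution_def)
    \<comment> \<open>Halving in \<open>?\<delta>\<close> offsets the division by 2 in the average:
      as neither summand exceeds \<open>s\<close>, each must exceed
      \<open>s - min \<alpha> \<beta>\<close>.\<close>
    with c have "2 * s - min \<alpha> \<beta> <
        convolution G v m (indicator (c <# A)) + convolution G u m (indicator (c <# A))"
      by (simp add: near_def field_simps)
    then show "near v \<alpha> c" "near u \<beta> c"
      using convolution_l_coset_le[OF v(1) m A cG le] convolution_l_coset_le[OF u(1) m A cG le] cG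
      unfolding near_def by linarith+
  qed
  have point: "mean (carrier G) {} (\<lambda>f. if bounded_fun (carrier G) f then f \<one> else 0)"
    by (rule mean_point) simp
  \<comment> \<open>Convolving with the point mass at \<open>\<one>\<close> gives back
    \<open>m\<close>, so \<open>near\<close> for it bounds \<open>m (c A)\<close> itself from
    below.\<close>
  have near_point: "s - \<delta> < m (indicator (c <# A))"
    if "near (\<lambda>f. if bounded_fun (carrier G) f then f \<one> else 0) \<delta> c" for \<delta> c
  proof -
    have "m (\<lambda>y. indicator (c <# A) (\<one> \<otimes> y)) = m (indicator (c <# A))"
      by (intro mean_cong[OF m]) auto
    then show ?thesis
      using that bounded_fun_mean_l_mult[OF m, of "indicator (c <# A)"]
      by (simp add: near_def convolution_def)
  qed
  have meet: "\<exists>c. near w \<delta> c \<and> near v \<alpha> c"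
    if "mean (carrier G) {} w" "0 < \<delta>" "mean (carrier G) {} v" "0 < \<alpha>" for w v \<delta> \<alpha>
    using common[OF that] extremal unfolding near_def by blast
  have small_mono: "small D z \<epsilon>" if "small E z \<epsilon>" "D \<subseteq> E" for D E z \<epsilon>
  proof -
    have "m (\<lambda>y. indicator D (z \<otimes> inv y \<otimes> c)) \<le> m (\<lambda>y. indicator E (z \<otimes> inv y \<otimes> c))" for c
      using that(2) by (intro mean_mono[OF m] bounded_fun_indicator) (auto simp: indicator_def)
    with that(1) show ?thesis unfolding small_def by (meson le_less_trans)
  qed
  have small_Un: "small (D \<union> E) z \<epsilon>" if "small D z (\<epsilon> / 2)" "small E z (\<epsilon> / 2)" for D E z \<epsilon>
  proof -
    obtain v \<alpha> u \<beta> where v: "mean (carrier G) {} v" "0 < \<alpha>"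
        "\<And>c. near v \<alpha> c \<Longrightarrow> m (\<lambda>y. indicator D (z \<otimes> inv y \<otimes> c)) < \<epsilon> / 2"
      and u: "mean (carrier G) {} u" "0 < \<beta>"
        "\<And>c. near u \<beta> c \<Longrightarrow> m (\<lambda>y. indicator E (z \<otimes> inv y \<otimes> c)) < \<epsilon> / 2"
      using \<open>small D z (\<epsilon> / 2)\<close> \<open>small E z (\<epsilon> / 2)\<close> unfolding small_def by metis
    have "m (\<lambda>y. indicator (D \<union> E) (z \<otimes> inv y \<otimes> c)) < \<epsilon>" if "near v \<alpha> c" "near u \<beta> c" for c
    proof -
      have "m (\<lambda>y. indicator (D \<union> E) (z \<otimes> inv y \<otimes> c)) \<le>
          m (\<lambda>y. indicator D (z \<otimes> inv y \<otimes> c) + indicator E (z \<otimes> inv y \<otimes> c))"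
        by (intro mean_mono[OF m] bounded_fun_add bounded_fun_indicator) (auto simp: indicator_def)
      also have "\<dots> = m (\<lambda>y. indicator D (z \<otimes> inv y \<otimes> c)) + m (\<lambda>y. indicator E (z \<otimes> inv y \<otimes> c))"
        by (intro mean_add[OF m]) auto
      finally show ?thesis using v(3)[OF that(1)] u(3)[OF that(2)] by linarith
    qed
    then show ?thesis unfolding small_def using common[OF v(1,2) u(1,2)] by metis
  qed
  have "boolean_ideal (carrier G) \<J>"
    unfolding boolean_ideal_def
  proof (intro conjI ballI allI impI)
    have "small {} z \<epsilon>" if "0 < \<epsilon>" for z \<epsilon>
    proof -
      have "m (\<lambda>y. indicator {} (z \<otimes> inv y \<otimes> c)) < \<epsilon>" for c
        using mean_const[OF m, of 0] that by simp
      then show ?thesis unfolding small_def using point zero_less_one by blast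
    qed
    then show "\<J> \<noteq> {}" unfolding \<J>_def by auto
    \<comment> \<open>Properness: \<open>extremal\<close> makes every set of the filter base
      nonempty, and at any of its elements the integrand is constantly 1.\<close>
    have "\<not> small (carrier G) \<one> 1"
    proof
      assume "small (carrier G) \<one> 1"
      then obtain w \<delta> where w: "mean (carrier G) {} w" "0 < \<delta>"
        "\<And>c. near w \<delta> c \<Longrightarrow> m (\<lambda>y. indicator (carrier G) (\<one> \<otimes> inv y \<otimes> c)) < 1"
        unfolding small_def by blast
      then obtain c where c: "near w \<delta> c" using extremal unfolding near_def by blast
      have "m (\<lambda>y. indicator (carrier G) (\<one> \<otimes> inv y \<otimes> c)) = m (\<lambda>_. 1)"
        using c by (intro mean_cong[OF m]) (auto simp: near_def)
      then show False using w(3)[OF c] mean_one[OF m] by simp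
    qed
    then have "carrier G \<notin> \<J>"
      unfolding \<J>_def using one_closed zero_less_one by blast
    moreover have "\<J> \<subseteq> Pow (carrier G)" unfolding \<J>_def by blast
    ultimately show "\<J> \<subset> Pow (carrier G)" by blast
  next
    fix D E S assume "D \<in> \<J>" "E \<in> \<J>" "S \<subseteq> D \<union> E"
    then show "S \<in> \<J>"
      unfolding \<J>_def using small_mono[OF small_Un] half_gt_zero by blast
  qed
  moreover have "x <# D \<in> \<J>" if x: "x \<in> carrier G" and D: "D \<in> \<J>" for x D
  proof -
    have DG: "D \<subseteq> carrier G" using D unfolding \<J>_def by blast
    have "m (\<lambda>y. indicator (x <# D) (z \<otimes> inv y \<otimes> c)) = m (\<lambda>y. indicator D ((inv x \<otimes> z) \<otimes> inv y \<otimes> c))"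
      if "z \<in> carrier G" "c \<in> carrier G" for z c
      using that x DG by (intro mean_cong[OF m]) (auto simp: indicator_def mem_l_coset_iff m_assoc)
    then have "small (x <# D) z \<epsilon> \<longleftrightarrow> small D (inv x \<otimes> z) \<epsilon>" if "z \<in> carrier G" for z \<epsilon>
      using that unfolding small_def near_def by simp
    then show ?thesis
      using x D l_coset_subset_G[OF DG x] unfolding \<J>_def by auto
  qed
  moreover have "set_inv A \<notin> \<J>"
  proof
    assume "set_inv A \<in> \<J>"
    \<comment> \<open>With \<open>s / 2\<close> as threshold on both sides, a common
      \<open>c\<close> has \<open>m (c A) < s / 2\<close> and
      \<open>m (c A) > s / 2\<close>.\<close>
    then have "small (set_inv A) \<one> (s / 2)" using t unfolding \<J>_def by auto
    then obtain w \<delta> where w: "mean (carrier G) {} w" "0 < \<delta>"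
      "\<And>c. near w \<delta> c \<Longrightarrow> m (\<lambda>y. indicator (set_inv A) (\<one> \<otimes> inv y \<otimes> c)) < s / 2"
      unfolding small_def by blast
    obtain c where c: "near w \<delta> c" "near (\<lambda>f. if bounded_fun (carrier G) f then f \<one> else 0) (s / 2) c"
      using meet[OF w(1,2) point, of "s / 2"] t by auto
    then have cG: "c \<in> carrier G" by (simp add: near_def)
    have "inv y \<otimes> c \<in> set_inv A \<longleftrightarrow> y \<in> c <# A" if y: "y \<in> carrier G" for y
    proof -
      have "inv y \<otimes> c = inv (inv c \<otimes> y)" using y cG by (simp add: inv_mult_group)
      moreover have "inv (inv c \<otimes> y) \<in> set_inv A \<longleftrightarrow> inv c \<otimes> y \<in> A"
        using A y cG unfolding SET_INV_def by (auto dest!: inv_inj[THEN inj_onD])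
      ultimately show ?thesis using A y cG by (simp add: mem_l_coset_iff)
    qed
    then have "m (\<lambda>y. indicator (set_inv A) (\<one> \<otimes> inv y \<otimes> c)) = m (indicator (c <# A))"
      by (intro mean_cong[OF m]) (auto simp: indicator_def)
    then show False using w(3)[OF c(1)] near_point[OF c(2)] by simp
  qed
  moreover have "{c \<in> carrier G. m (indicator (c <# A)) \<le> t} \<in> \<J>" (is "?C \<in> \<J>")
  proof -
    have "small ?C z \<epsilon>" if z: "z \<in> carrier G" and \<epsilon>: "0 < \<epsilon>" for z \<epsilon>
    proof -
      \<comment> \<open>Here \<open>w\<close> is the convolution of \<open>m\<close> with the point mass at \<open>inv z\<close>, so that
        \<open>(w * m) (c A)\<close> is the \<open>m\<close>-average over \<open>y\<close> of \<open>m ((z y\<^sup>-\<^sup>1 c) A)\<close>.\<close>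
      define w where "w f = (if bounded_fun (carrier G) f then m (\<lambda>y. f (y \<otimes> inv z)) else 0)" for f
      have bd: "bounded_fun (carrier G) (\<lambda>y. f (y \<otimes> inv z))" if "bounded_fun (carrier G) f" for f
        using bounded_fun_compose[OF that, of "\<lambda>y. y \<otimes> inv z"] z by simp
      have w: "mean (carrier G) {} w"
        using mean_nonneg[OF m bd] z
        unfolding mean_def[of _ _ w] w_def
        by (auto simp: mean_one[OF m] mean_add[OF m bd bd] mean_cmult[OF m bd])
      \<comment> \<open>Markov inequality: \<open>?h\<close> is at most \<open>s\<close> everywhere
        and at most \<open>t\<close> on \<open>?C\<close>, so mass \<open>\<epsilon>\<close> on
        \<open>?C\<close> would lower the average by at least \<open>(s - t) * \<epsilon>\<close>,
        which is the tolerance chosen here.\<close>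
      have "m (\<lambda>y. indicator ?C (z \<otimes> inv y \<otimes> c)) < \<epsilon>" if c: "near w ((s - t) * \<epsilon>) c" for c
      proof -
        have cG: "c \<in> carrier G" using c by (simp add: near_def)
        let ?h = "\<lambda>c. m (indicator (c <# A))"
        have nn: "0 \<le> ?h x" for x using mean_indicator_nonneg[OF m, of _ "\<lambda>x. x"] by simp
        have hb: "bounded_fun (carrier G) (\<lambda>g. ?h (inv g \<otimes> c))"
          using cG le nn by (intro bounded_funI[of _ _ s]) auto
        have "convolution G w m (indicator (c <# A)) = w (\<lambda>g. ?h (inv g \<otimes> c))"
          by (rule convolution_l_coset[OF w m A cG])
        also have "\<dots> = m (\<lambda>y. ?h (inv (y \<otimes> inv z) \<otimes> c))"
          using hb by (simp add: w_def)
        also have "\<dots> \<le> m (\<lambda>y. s + (t - s) * indicator ?C (z \<otimes> inv y \<otimes> c))"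
        proof (intro mean_mono[OF m] bd[OF hb] bounded_fun_add bounded_fun_cmult)
          fix y assume y: "y \<in> carrier G"
          have "inv (y \<otimes> inv z) \<otimes> c = z \<otimes> inv y \<otimes> c" "z \<otimes> inv y \<otimes> c \<in> carrier G"
            using y z cG by (auto simp: inv_mult_group)
          then show "?h (inv (y \<otimes> inv z) \<otimes> c) \<le> s + (t - s) * indicator ?C (z \<otimes> inv y \<otimes> c)"
            using le by (simp add: indicator_def)
        qed auto
        also have "\<dots> = s + (t - s) * m (\<lambda>y. indicator ?C (z \<otimes> inv y \<otimes> c))"
          by (simp add: mean_add[OF m] mean_cmult[OF m] mean_const[OF m])
        finally have "(s - t) * m (\<lambda>y. indicator ?C (z \<otimes> inv y \<otimes> c)) < (s - t) * \<epsilon>"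
          using c unfolding near_def by (simp add: algebra_simps)
        then show ?thesis using t by simp
      qed
      moreover have "0 < (s - t) * \<epsilon>" using \<epsilon> t by simp
      ultimately show ?thesis unfolding small_def using w by blast
    qed
    then show ?thesis unfolding \<J>_def by blast
  qed
  ultimately show ?thesis unfolding left_invariant_boolean_ideal_def by blast
qed


subsection \<open>Covering by translates of difference sets\<close>

text \<open>Left translation by \<open>x\<close> preserves \<open>\<N>\<close> and carries
  \<open>((inv x \<otimes> y) <# A) \<inter> A\<close> to
  \<open>(x <# A) \<inter> (y <# A)\<close>.\<close>

lemma Delta_memI:
  assumes "\<And>x S. x \<in> carrier G \<Longrightarrow> S \<in> \<N> \<Longrightarrow> x <# S \<in> \<N>" "A \<subseteq> carrier G"
    and "x \<in> carrier G" "y \<in> carrier G" "(x <# A) \<inter> (y <# A) \<notin> \<N>"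
  shows "inv x \<otimes> y \<in> Delta G \<N> A"
proof (rule ccontr)
  assume "inv x \<otimes> y \<notin> Delta G \<N> A"
  then have "((inv x \<otimes> y) <# A) \<inter> A \<in> \<N>" using assms(3,4) by (simp add: Delta_def)
  then have "x <# (((inv x \<otimes> y) <# A) \<inter> A) \<in> \<N>" using assms(1,3) by blast
  also have "x <# (((inv x \<otimes> y) <# A) \<inter> A) = (x <# A) \<inter> (y <# A)"
  proof (rule Set.set_eqI)
    fix v show "v \<in> x <# (((inv x \<otimes> y) <# A) \<inter> A) \<longleftrightarrow> v \<in> (x <# A) \<inter> (y <# A)"
    proof (cases "v \<in> carrier G")
      case True
      have "((inv x \<otimes> y) <# A) \<inter> A \<subseteq> carrier G" using assms(2) by blast
      moreover have "x \<otimes> (inv x \<otimes> v) = v" using True assms(3) by (simp add: m_assoc[symmetric])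
      ultimately show ?thesis
        using True assms(2-4) by (auto simp: mem_l_coset_iff inv_mult_group m_assoc)
    next
      case False
      then have "v \<notin> x <# S" if "S \<subseteq> carrier G" for S
        using l_coset_subset_G[OF that assms(3)] by blast
      with assms(2) show ?thesis by blast
    qed
  qed
  finally show False using assms(5) by simp
qed

text \<open>Greedy choice: each new \<open>f k\<close> is taken outside the union of the
  \<open>f l \<Delta>(A)\<close> with \<open>l < k\<close>. An intersection of
  \<open>f l <# A\<close> and \<open>f k <# A\<close> outside \<open>\<N>\<close> would put
  \<open>f k\<close> into \<open>f l \<Delta>(A)\<close>.\<close>

lemma almost_disjoint_translates:
  assumes inv: "\<And>x S. x \<in> carrier G \<Longrightarrow> S \<in> \<N> \<Longrightarrow> x <# S \<in> \<N>" and A: "A \<subseteq> carrier G"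
    and cov: "\<not> cov G (Delta G \<N> A) \<le> enat n"
  shows "\<exists>f. (\<forall>k\<le>n. f k \<in> carrier G) \<and>
    (\<forall>k\<le>n. \<forall>l\<le>n. k \<noteq> l \<longrightarrow> (f k <# A) \<inter> (f l <# A) \<in> \<N>)"
proof -
  let ?D = "Delta G \<N> A"
  have D: "?D \<subseteq> carrier G" by (auto simp: Delta_def)
  have uncovered: "\<exists>x\<in>carrier G. x \<notin> F <#> ?D" if F: "F \<subseteq> carrier G" "finite F" "card F \<le> n" for F
  proof (rule ccontr)
    assume "\<not> ?thesis"
    then have eq: "carrier G = F <#> ?D" using set_mult_closed[OF F(1) D] by blast
    \<comment> \<open>Needed because \<open>cov\<close> of the empty set is infinite by convention
      and not an infimum.\<close>
    then have "?D \<noteq> {}" using one_closed by (auto simp: set_mult_def)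
    then have "cov G ?D \<le> ecard F"
      unfolding cov_def using F eq by (auto intro!: Inf_lower)
    also have "\<dots> \<le> enat n" using F by (simp add: ecard_def)
    finally show False using cov by simp
  qed
  \<comment> \<open>The last element, \<open>f n\<close>, is chosen against \<open>n\<close> earlier
    ones, the most that \<open>uncovered\<close> allows; this yields \<open>n + 1\<close> elements
    in all.\<close>
  have "\<exists>f. \<forall>l<k. f l \<in> carrier G \<and> f l \<notin> (f ` {..<l}) <#> ?D" if "k \<le> Suc n" for k
    using that
  proof (induction k)
    case (Suc k)
    then obtain f where f: "\<forall>l<k. f l \<in> carrier G \<and> f l \<notin> (f ` {..<l}) <#> ?D" by auto
    have "card (f ` {..<k}) \<le> k" using card_image_le[of "{..<k}" f] by simp
    then obtain x where x: "x \<in> carrier G" "x \<notin> (f ` {..<k}) <#> ?D"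
      using uncovered[of "f ` {..<k}"] f Suc.prems by auto
    show ?case
    proof (intro exI[of _ "f(k := x)"] allI impI)
      fix l assume "l < Suc k"
      moreover from this have "(f(k := x)) ` {..<l} = f ` {..<l}" by (intro image_cong) auto
      ultimately show "(f(k := x)) l \<in> carrier G \<and> (f(k := x)) l \<notin> (f(k := x)) ` {..<l} <#> ?D"
        using f x by (cases "l = k") simp_all
    qed
  qed simp
  then obtain f where f: "\<forall>l<Suc n. f l \<in> carrier G \<and> f l \<notin> (f ` {..<l}) <#> ?D" by blast
  have disj: "(f l <# A) \<inter> (f k <# A) \<in> \<N>" if "l < k" "k \<le> n" for l k
  proof (rule ccontr)
    assume "\<not> ?thesis"
    then have "inv f l \<otimes> f k \<in> ?D" using f that by (intro Delta_memI[OF inv A]) auto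
    moreover have "f k = f l \<otimes> (inv f l \<otimes> f k)" using f that by (simp add: m_assoc[symmetric])
    ultimately have "f k \<in> (f ` {..<k}) <#> ?D" using that unfolding set_mult_def by blast
    then show False using f that by auto
  qed
  have "(f k <# A) \<inter> (f l <# A) \<in> \<N>" if "k \<le> n" "l \<le> n" "k \<noteq> l" for k l
    using that disj[of k l] disj[of l k] by (cases "k < l") (auto simp: Int_commute)
  then show ?thesis using f by (intro exI[of _ f]) auto
qed

text \<open>Almost disjoint translates of mean above \<open>1 / n\<close> have total mean at most 1,
  so there are fewer than \<open>n\<close> of them. By maximality, \<open>F \<Delta>(A)\<close> can
  miss only elements of the given member of \<open>\<J>\<close>.\<close>

lemma cov_mod_less:
  assumes N: "boolean_ideal (carrier G) \<N>" "\<And>x S. x \<in> carrier G \<Longrightarrow> S \<in> \<N> \<Longrightarrow> x <# S \<in> \<N>"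
    and A: "A \<subseteq> carrier G" and m: "mean (carrier G) \<N> m"
    and J: "boolean_ideal (carrier G) \<J>"
      "{c \<in> carrier G. m (indicator (c <# A)) \<le> 1 / real n} \<in> \<J>"
    and "n \<ge> 1"
  shows "cov_mod G \<J> (Delta G \<N> A) < enat n"
proof -
  let ?D = "Delta G \<N> A" and ?good = "{c \<in> carrier G. 1 / real n < m (indicator (c <# A))}"
  have D: "?D \<subseteq> carrier G" by (auto simp: Delta_def)
  define adm where "adm F \<longleftrightarrow> finite F \<and> F \<subseteq> ?good \<and>
    (\<forall>x\<in>F. \<forall>y\<in>F. x \<noteq> y \<longrightarrow> (x <# A) \<inter> (y <# A) \<in> \<N>)" for F
  have card_less: "card F < n" if "adm F" for F
  proof (cases "F = {}")
    case True
    then show ?thesis using \<open>n \<ge> 1\<close> by simp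
  next
    case False
    have F: "finite F" "F \<subseteq> ?good" using that by (auto simp: adm_def)
    have "real (card F) * (1 / real n) = (\<Sum>x\<in>F. 1 / real n)" by simp
    also have "\<dots> < (\<Sum>x\<in>F. m (indicator (x <# A)))"
      using F False by (intro sum_strict_mono) auto
    also have "\<dots> = m (indicator (\<Union>x\<in>F. x <# A))"
      using that by (intro sum_mean_indicator[OF N(1) m]) (auto simp: adm_def)
    also have "\<dots> \<le> 1" using mean_indicator_le_one[OF m, of _ "\<lambda>x. x"] by simp
    finally show ?thesis using \<open>n \<ge> 1\<close> by (simp add: field_simps)
  qed
  have "adm {}" by (simp add: adm_def)
  then obtain F where F: "adm F" and max: "\<And>E. adm E \<Longrightarrow> card E \<le> card F"
    using ex_has_greatest_nat[of adm "{}" card n] card_less by (metis less_imp_le)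
  have FG: "F \<subseteq> carrier G" "finite F" using F by (auto simp: adm_def)
  \<comment> \<open>This serves the elements of \<open>F\<close> itself: they are covered because
    \<open>c <# A\<close> meets itself outside \<open>\<N>\<close>.\<close>
  have not_null: "x <# A \<notin> \<N>" if "x \<in> ?good" for x
  proof
    assume "x <# A \<in> \<N>"
    then have "m (indicator (x <# A)) = 0" by (rule mean_null[OF m])
    then show False using that by (simp add: field_simps)
  qed
  have covered: "c \<in> F <#> ?D" if c: "c \<in> ?good" for c
  proof -
    have "\<exists>x\<in>F. (x <# A) \<inter> (c <# A) \<notin> \<N>"
    proof (cases "c \<in> F")
      case True
      then show ?thesis using not_null[OF c] by (intro bexI[of _ c]) simp_all
    next
      case False
      then have "\<not> adm (insert c F)" using max[of "insert c F"] FG by auto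
      then show ?thesis using F c unfolding adm_def by (auto simp: Int_commute)
    qed
    then obtain x where x: "x \<in> F" "(x <# A) \<inter> (c <# A) \<notin> \<N>" by blast
    then have "inv x \<otimes> c \<in> ?D" using c FG by (intro Delta_memI[OF N(2) A]) auto
    moreover have "c = x \<otimes> (inv x \<otimes> c)" using c x FG by (auto simp: m_assoc[symmetric])
    ultimately show ?thesis using x unfolding set_mult_def by blast
  qed
  have "sym_diff (F <#> ?D) (carrier G) \<subseteq> {c \<in> carrier G. m (indicator (c <# A)) \<le> 1 / real n}"
    using covered set_mult_closed[OF FG(1) D] by force
  then have eq: "eq_mod_ideal \<J> (F <#> ?D) (carrier G)"
    unfolding eq_mod_ideal_def using boolean_ideal_subset[OF J] by blast
  \<comment> \<open>Without such a \<open>c\<close> the whole group would belong to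
    \<open>\<J>\<close>. It shows that \<open>?D\<close> is nonempty, so that \<open>cov_mod\<close>
    is the infimum and not the default infinity.\<close>
  obtain c where "c \<in> ?good"
    using boolean_ideal_subset[OF J] boolean_ideal_carrier[OF J(1)] by (metis (no_types, lifting) mem_Collect_eq not_less subsetI)
  then have "?D \<noteq> {}" using covered by (auto simp: set_mult_def)
  then have "cov_mod G \<J> ?D \<le> ecard F"
    unfolding cov_mod_def using FG eq by (auto intro!: Inf_lower)
  also have "\<dots> < enat n" using FG card_less[OF F] by (simp add: ecard_def)
  finally show ?thesis .
qed

end

section \<open>Minimality, double counting and the choice of the index\<close>

theorem theorem3:
  fixes G :: "('a, 'b) monoid_scheme" and \<I> :: "'a set set"
    and n :: nat and A :: "nat \<Rightarrow> 'a set"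
  assumes "group G"
    and "invariant_boolean_ideal G \<I>"
    and "\<exists>C. C \<subseteq> carrier G \<and> countable C \<and> C \<notin> \<I>"
    and "n \<ge> 1"
    and "(\<Union>i\<in>{1..n}. A i) = carrier G"
    and "disjoint_family_on A {1..n}"
  shows "(\<forall>i\<in>{1..n}. cov G (Delta G \<I> (A i)) \<le> enat n) \<or>
    (\<exists>i\<in>{1..n}. \<exists>\<J>. left_invariant_boolean_ideal G \<J> \<and>
       set_inv\<^bsub>G\<^esub> (A i) \<notin> \<J> \<and>
       cov_mod G \<J> (Delta G \<I> (A i)) < enat n)"
  unfolding disj_imp
proof
  interpret group G by fact
  let ?X = "carrier G"
  assume "\<not> (\<forall>i\<in>{1..n}. cov G (Delta G \<I> (A i)) \<le> enat n)"
  then obtain i where i: "i \<in> {1..n}" "\<not> cov G (Delta G \<I> (A i)) \<le> enat n" by blast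
  have I: "boolean_ideal ?X \<I>" using assms(2) by (simp add: invariant_boolean_ideal_def)
  then have I_sub: "\<I> \<subseteq> Pow ?X" by (auto simp: boolean_ideal_def)
  have inv: "x <#\<^bsub>G\<^esub> S \<in> \<I>" if "x \<in> ?X" "S \<in> \<I>" for x S
  proof -
    have "(x <#\<^bsub>G\<^esub> S) #>\<^bsub>G\<^esub> \<one>\<^bsub>G\<^esub> \<in> \<I>" using assms(2) that by (auto simp: invariant_boolean_ideal_def)
    moreover have "x <#\<^bsub>G\<^esub> S \<subseteq> ?X" using that I_sub by (intro l_coset_subset_G) auto
    ultimately show ?thesis by simp
  qed
  have A: "A j \<subseteq> ?X" if "j \<in> {1..n}" for j using that assms(5) by blast
  obtain m s where m: "mean ?X \<I> m" and s01: "\<And>j. s j \<in> {0..1::real}"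
    and le: "\<And>j c. j \<in> {1..n} \<Longrightarrow> c \<in> ?X \<Longrightarrow> m (indicator (c <#\<^bsub>G\<^esub> A j)) \<le> s j"
    and minimal: "\<forall>m' s'. mean ?X \<I> m' \<and> (\<forall>j. s' j \<in> {0..1}) \<and>
      (\<forall>j\<in>{1..n}. \<forall>c\<in>?X. m' (indicator (c <#\<^bsub>G\<^esub> A j)) \<le> s' j) \<longrightarrow>
      sum s {1..n} \<le> sum s' {1..n}"
    by (rule minimal_mean_exists[OF I, of "{1..n}" ?X "\<lambda>j c. c <#\<^bsub>G\<^esub> A j"]) (rule that)
  \<comment> \<open>Otherwise the convolution of \<open>w\<close> with \<open>m\<close>, with
    \<open>s j\<close> lowered by \<open>\<delta>\<close> and the other bounds kept, would have a
    smaller sum than the minimal one.\<close>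
  have extremal: "\<exists>c\<in>?X. s j - \<delta> < convolution G w m (indicator (c <#\<^bsub>G\<^esub> A j))"
    if j: "j \<in> {1..n}" and w: "mean ?X {} w" and \<delta>: "0 < \<delta>" for j w \<delta>
  proof (rule ccontr)
    assume "\<not> ?thesis"
    then have small: "convolution G w m (indicator (c <#\<^bsub>G\<^esub> A j)) \<le> s j - \<delta>" if "c \<in> ?X" for c
      using that by force
    have mc: "mean ?X \<I> (convolution G w m)" by (rule mean_convolution[OF w m I_sub inv])
    \<comment> \<open>The lowered bound must stay in \<open>{0..1}\<close> to compete in the
      minimization.\<close>
    have "0 \<le> s j - \<delta>"
      using small[OF one_closed] mean_indicator_nonneg[OF mc, of "\<one>\<^bsub>G\<^esub> <#\<^bsub>G\<^esub> A j" "\<lambda>x. x"] by simp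
    then have "\<forall>l. (s(j := s j - \<delta>)) l \<in> {0..1}"
      using s01 \<delta> by (auto intro: order_trans[of "s j - \<delta>" "s j" 1])
    moreover have "\<forall>l\<in>{1..n}. \<forall>c\<in>?X.
        convolution G w m (indicator (c <#\<^bsub>G\<^esub> A l)) \<le> (s(j := s j - \<delta>)) l"
      using small convolution_l_coset_le[OF w m A _ le] by simp
    ultimately have "sum s {1..n} \<le> sum (s(j := s j - \<delta>)) {1..n}"
      using minimal mc by blast
    moreover have "sum (s(j := s j - \<delta>)) {1..n} < sum s {1..n}"
      using j \<delta> by (intro sum_strict_mono_ex1) auto
    ultimately show False by simp
  qed
  obtain f where f: "\<And>k. k \<le> n \<Longrightarrow> f k \<in> ?X"
    and disj: "\<And>k l. k \<le> n \<Longrightarrow> l \<le> n \<Longrightarrow> k \<noteq> l \<Longrightarrow> (f k <#\<^bsub>G\<^esub> A i) \<inter> (f l <#\<^bsub>G\<^esub> A i) \<in> \<I>"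
    using almost_disjoint_translates[OF inv A i(2)] i(1) by blast
  let ?a = "\<lambda>j k. m (indicator (f k <#\<^bsub>G\<^esub> A j))"
  have sum_i: "(\<Sum>k\<le>n. ?a i k) \<le> 1"
    using sum_mean_indicator[OF I m, of "{..n}" "\<lambda>k. f k <#\<^bsub>G\<^esub> A i"] disj
      mean_indicator_le_one[OF m, of _ "\<lambda>x. x"] by simp
  have sum_j: "(\<Sum>j\<in>{1..n}. ?a j k) = 1" if k: "k \<le> n" for k
  proof -
    have "(f k <#\<^bsub>G\<^esub> A j) \<inter> (f k <#\<^bsub>G\<^esub> A l) = {}"
      if jl: "j \<in> {1..n}" "l \<in> {1..n}" "j \<noteq> l" for j l
    proof -
      have "A j \<inter> A l = {}" using assms(6) jl by (simp add: disjoint_family_on_def)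
      moreover have "a = b" if "f k \<otimes>\<^bsub>G\<^esub> a = f k \<otimes>\<^bsub>G\<^esub> b" "a \<in> A j" "b \<in> A l" for a b
        using that A[OF jl(1)] A[OF jl(2)] f[OF k] Units_l_cancel Units_eq by (metis subsetD)
      ultimately show ?thesis unfolding l_coset_def by blast
    qed
    moreover have "{} \<in> \<I>" using boolean_ideal_Union[OF I, of "{}"] by simp
    ultimately have "(\<Sum>j\<in>{1..n}. ?a j k) = m (indicator (\<Union>j\<in>{1..n}. f k <#\<^bsub>G\<^esub> A j))"
      by (intro sum_mean_indicator[OF I m]) auto
    also have "(\<Union>j\<in>{1..n}. f k <#\<^bsub>G\<^esub> A j) = f k <#\<^bsub>G\<^esub> (\<Union>j\<in>{1..n}. A j)"
      by (auto simp: l_coset_def)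
    also have "m (indicator \<dots>) = m (\<lambda>_. 1)"
      unfolding assms(5) using f[OF k] by (intro mean_cong[OF m]) (simp add: mem_l_coset_iff indicator_def)
    finally show ?thesis by (simp add: mean_one[OF m])
  qed
  \<comment> \<open>Double counting: otherwise the total mass \<open>n + 1\<close> would be at most
    1 from the index \<open>i\<close> plus \<open>(n - 1) * (n + 1) / n = n - 1 / n\<close> from the
    others.\<close>
  have "\<exists>j\<in>{1..n}. \<exists>k\<le>n. 1 / real n < ?a j k"
  proof (rule ccontr)
    assume "\<not> ?thesis"
    then have a: "?a j k \<le> 1 / real n" if "j \<in> {1..n}" "k \<le> n" for j k using that by force
    have "real n + 1 = (\<Sum>k\<le>n. \<Sum>j\<in>{1..n}. ?a j k)" using sum_j by simp
    also have "\<dots> = (\<Sum>j\<in>{1..n}. \<Sum>k\<le>n. ?a j k)" by (rule sum.swap)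
    also have "\<dots> = (\<Sum>k\<le>n. ?a i k) + (\<Sum>j\<in>{1..n} - {i}. \<Sum>k\<le>n. ?a j k)"
      using i(1) by (simp add: sum.remove)
    also have "\<dots> \<le> 1 + (\<Sum>j\<in>{1..n} - {i}. \<Sum>k\<le>n. 1 / real n)"
      using a sum_i by (intro add_mono sum_mono) auto
    also have "\<dots> = 1 + (real n - 1) * (real n + 1) / real n"
      using i(1) by (simp add: of_nat_diff algebra_simps)
    also have "\<dots> < 1 + real n" using \<open>n \<ge> 1\<close> by (simp add: field_simps)
    finally show False by simp
  qed
  then obtain j k where j: "j \<in> {1..n}" and k: "k \<le> n" "1 / real n < ?a j k" by blast
  \<comment> \<open>The index \<open>j\<close> may differ from \<open>i\<close>. The strict gap
    allows \<open>t = 1 / n\<close> in the construction of the ideal, the threshold that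
    \<open>cov_mod_less\<close> requires.\<close>
  have "1 / real n < s j" using k le[OF j f[OF k(1)]] by linarith
  then obtain \<J> where J: "left_invariant_boolean_ideal G \<J>" "set_inv\<^bsub>G\<^esub> (A j) \<notin> \<J>"
    "{c \<in> ?X. m (indicator (c <#\<^bsub>G\<^esub> A j)) \<le> 1 / real n} \<in> \<J>"
    using ideal_of_extremal_mean[OF m A[OF j] le[OF j] extremal[OF j], of "1 / real n"] by auto
  moreover have "cov_mod G \<J> (Delta G \<I> (A j)) < enat n"
    using J(1,3) \<open>n \<ge> 1\<close> unfolding left_invariant_boolean_ideal_def
    by (intro cov_mod_less[OF I inv A[OF j] m]) auto
  ultimately show "\<exists>i\<in>{1..n}. \<exists>\<J>. left_invariant_boolean_ideal G \<J> \<and>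
       set_inv\<^bsub>G\<^esub> (A i) \<notin> \<J> \<and> cov_mod G \<J> (Delta G \<I> (A i)) < enat n"
    using j by blast
qed

end
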